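(* Let $\mu\in\mathcal{P}(\Theta)$ and let $\Phi_1,\Phi_2\in L^0(\Theta,\mathbb{R})$ be such that $\mu_{\Phi_i}\in\mathcal{P}(\Theta)$ for $i=1,2$. (i) If $\operatorname{ess\,inf}_\mu\Phi_i=0$ for $i=1,2$, then $$|Z_{\Phi_2,\mu}-Z_{\Phi_1,\mu}|\;\leq\;\Vert e^{-\Phi_1}-e^{-\Phi_2}\Vert_{L^1_\mu}\;\leq\;\Vert\Phi_1-\Phi_2\Vert_{L^1_\mu}\qquad(\mathrm{A})$$ and $$d_{\mathrm{TV}}(\mu_{\Phi_1},\mu_{\Phi_2})\leq\frac12\,\frac{1}{Z_{\Phi_1,\mu}\vee Z_{\Phi_2,\mu}}\left(\Vert e^{-\Phi_1}-e^{-\Phi_2}\Vert_{L^1_\mu}+|Z_{\Phi_2,\mu}-Z_{\Phi_1,\mu}|\right).\qquad(\mathrm{B})$$ If $\Phi_1=\Phi_2$ $\mu$-a.s., then equality holds in the second inequality of (A) and in (B). Equality holds in the first inequality of (A) if and only if $\Phi_1-\Phi_2$ $\mu$-a.s. does not change sign (i.e. $\Phi_1\geq\Phi_2$ $\mu$-a.s. or $\Phi_1\leq\Phi_2$ $\mu$-a.s.). (ii) If $\Phi_i\in L^\infty_\mu(\Theta,\mathbb{R})$ for $i=1,2$, and both $\mu(\Phi_1-\Phi_2>0)$ and $\mu(\Phi_1-\Phi_2<0)$ are positive, then $$d_{\mathrm{TV}}(\mu_{\Phi_1},\mu_{\Phi_2})>\begin{cases}\dfrac12\,\dfrac{\exp(-\Vert\Phi_1\Vert_{L^\infty_\mu})\wedge\exp(-\Vert\Phi_2\Vert_{L^\infty_\mu})}{Z_{\Phi_1,\mu}\wedge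 Z_{\Phi_2,\mu}}\Vert\Phi_1-\Phi_2\Vert_{L^1_\mu}, & Z_{\Phi_1,\mu}=Z_{\Phi_2,\mu},\\[2mm] \exp(-\Vert\Phi_1\Vert_{L^\infty_\mu})\,Z_{\Phi_2,\mu}^{-1}\displaystyle\int_{\{\Phi_1>\Phi_2\}}|\Phi_1-\Phi_2|\,\mathrm{d}\mu, & Z_{\Phi_1,\mu}>Z_{\Phi_2,\mu},\\[2mm] \exp(-\Vert\Phi_2\Vert_{L^\infty_\mu})\,Z_{\Phi_1,\mu}^{-1}\displaystyle\int_{\{\Phi_2>\Phi_1\}}|\Phi_1-\Phi_2|\,\mathrm{d}\mu, & Z_{\Phi_1,\mu}<Z_{\Phi_2,\mu}.\end{cases}$$ (iii) If $\Phi_i\in L^\infty_\mu(\Theta,\mathbb{R})$ for $i=1,2$ and either $\mu(\Phi_1-\Phi_2\geq 0)=1$ or $\mu(\Phi_1-\Phi_2\leq 0)=1$, then $$d_{\mathrm{TV}}(\mu_{\Phi_1},\mu_{\Phi_2})\geq\begin{cases}\dfrac12\,\dfrac{\exp(-\Vert\Phi_1\Vert_{L^\infty_\mu})\wedge\exp(-\Vert\Phi_2\Vert_{L^\infty_\mu})}{Z_{\Phi_1,\mu}\wedge Z_{\Phi_2,\mu}}\Vert\Phi_1-\Phi_2\Vert_{L^1_\mu}, & Z_{\Phi_1,\mu}=Z_{\Phi_2,\mu},\\ 0, & \text{otherwise.}\end{cases}$$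
   Context: $(\Theta,\Sigma)$ is a measurable space and $\mathcal{P}(\Theta)$ is the set of probability measures on it. $L^0(\Theta,\mathbb{R})$ is the set of $\Sigma$-measurable functions $\Theta\to\mathbb{R}$, and $L^\infty_\mu(\Theta,\mathbb{R})$ the $\mu$-essentially bounded ones. For $\Phi\in L^0(\Theta,\mathbb{R})$ and $\mu\in\mathcal{P}(\Theta)$: $Z_{\Phi,\mu}:=\int e^{-\Phi}\,\mathrm{d}\mu$; if $0<Z_{\Phi,\mu}<\infty$, then $\mu_\Phi$ is the measure with $\frac{\mathrm{d}\mu_\Phi}{\mathrm{d}\mu}=e^{-\Phi}/Z_{\Phi,\mu}$. The requirement $\mu_\Phi\in\mathcal{P}(\Theta)$ means $0<Z_{\Phi,\mu}<\infty$. The total variation metric is $d_{\mathrm{TV}}(\mu_1,\mu_2):=\sup_{A\in\Sigma}|\mu_1(A)-\mu_2(A)|=\frac12\int\left|\frac{\mathrm{d}\mu_1}{\mathrm{d}\nu}-\frac{\mathrm{d}\mu_2}{\mathrm{d}\nu}\right|\mathrm{d}\nu$ for any $\nu\in\mathcal{P}(\Theta)$ with $\mu_1,\mu_2\ll\nu$. $a\wedge b:=\min\{a,b\}$, $a\vee b:=\max\{a,b\}$. The norm $\Vert\Phi_1-\Phi_2\Vert_{L^1_\mu}$ in (A) may be $+\infty$. *)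

theory Defs
  imports "HOL-Probability.Probability"
begin

text \<open>
  The nonnegative quantities below live in \<^typ>\<open>ennreal\<close>, so that infinite
  \<open>L\<^sup>1\<close>-norms are represented faithfully. \<open>L\<^sup>0\<close> is \<^term>\<open>borel_measurable \<mu>\<close>.
\<close>

definition Z_const :: "'a measure \<Rightarrow> ('a \<Rightarrow> real) \<Rightarrow> ennreal" where
  "Z_const \<mu> \<Phi> = (\<integral>\<^sup>+ x. ennreal (exp (- \<Phi> x)) \<partial>\<mu>)"

text \<open>The measure \<open>\<mu>\<^sub>\<Phi>\<close>; only meaningful when \<open>0 < Z_const \<mu> \<Phi> < \<infinity>\<close>.\<close>

definition reweighted :: "'a measure \<Rightarrow> ('a \<Rightarrow> real) \<Rightarrow> 'a measure" where
  "reweighted \<mu> \<Phi> = density \<mu> (\<lambda>x. ennreal (exp (- \<Phi> x)) / Z_const \<mu> \<Phi>)"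

lemma prob_space_reweighted:
  assumes [measurable]: "\<Phi> \<in> borel_measurable \<mu>"
    and Z: "0 < Z_const \<mu> \<Phi>" "Z_const \<mu> \<Phi> < \<infinity>"
  shows "prob_space (reweighted \<mu> \<Phi>)"
proof (rule prob_spaceI)
  have "emeasure (reweighted \<mu> \<Phi>) (space (reweighted \<mu> \<Phi>))
      = (\<integral>\<^sup>+ x. ennreal (exp (- \<Phi> x)) / Z_const \<mu> \<Phi> \<partial>\<mu>)"
    unfolding reweighted_def by (simp add: emeasure_density cong: nn_integral_cong)
  also have "\<dots> = Z_const \<mu> \<Phi> / Z_const \<mu> \<Phi>"
    by (simp add: nn_integral_divide Z_const_def)
  also have "\<dots> = 1"
    using Z by (simp add: ennreal_divide_self)
  finally show "emeasure (reweighted \<mu> \<Phi>) (space (reweighted \<mu> \<Phi>)) = 1" .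
qed

text \<open>To be used for two probability measures on the same \<open>\<sigma>\<close>-algebra.\<close>

definition tv_dist :: "'a measure \<Rightarrow> 'a measure \<Rightarrow> ennreal" where
  "tv_dist M N = (SUP A\<in>sets M. ennreal \<bar>measure M A - measure N A\<bar>)"

definition L1_norm :: "'a measure \<Rightarrow> ('a \<Rightarrow> real) \<Rightarrow> ennreal" where
  "L1_norm \<mu> f = (\<integral>\<^sup>+ x. ennreal \<bar>f x\<bar> \<partial>\<mu>)"

definition Linf_norm :: "'a measure \<Rightarrow> ('a \<Rightarrow> real) \<Rightarrow> ennreal" where
  "Linf_norm \<mu> f = esssup \<mu> (\<lambda>x. ennreal \<bar>f x\<bar>)"

definition L_infinity :: "'a measure \<Rightarrow> ('a \<Rightarrow> real) set" where
  "L_infinity \<mu> = {f \<in> borel_measurable \<mu>. Linf_norm \<mu> f < \<infinity>}"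

definition ess_inf :: "'a measure \<Rightarrow> ('a \<Rightarrow> real) \<Rightarrow> ereal" where
  "ess_inf \<mu> f = - esssup \<mu> (\<lambda>x. - ereal (f x))"

text \<open>\<open>exp (- \<parallel>f\<parallel>)\<close> for the \<open>L\<^sup>\<infinity>\<close>-norm; only meaningful for \<open>f \<in> L_infinity \<mu>\<close>, where
  \<^const>\<open>enn2real\<close> is lossless.\<close>

definition exp_neg_Linf :: "'a measure \<Rightarrow> ('a \<Rightarrow> real) \<Rightarrow> ennreal" where
  "exp_neg_Linf \<mu> f = ennreal (exp (- enn2real (Linf_norm \<mu> f)))"

text \<open>\<open>\<bar>a - b\<bar>\<close> for finite \<open>a\<close>, \<open>b\<close>, avoiding the truncated subtraction of \<^typ>\<open>ennreal\<close>.\<close>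

definition ennreal_absdiff :: "ennreal \<Rightarrow> ennreal \<Rightarrow> ennreal" where
  "ennreal_absdiff a b = ennreal \<bar>enn2real a - enn2real b\<bar>"

end

theory Submission
  imports Defs
begin

text \<open>
  With \<open>z\<^sub>i = \<integral> exp (- \<Phi>\<^sub>i) d\<mu>\<close>, the total variation distance of the reweighted measures is
  \<open>1/2 \<integral> \<bar>exp (- \<Phi>\<^sub>1) / z\<^sub>1 - exp (- \<Phi>\<^sub>2) / z\<^sub>2\<bar> d\<mu>\<close>. For the upper bound, the difference of the
  densities is split as \<open>(exp (- \<Phi>\<^sub>1) - exp (- \<Phi>\<^sub>2)) / z\<^sub>1 + exp (- \<Phi>\<^sub>2) (1 / z\<^sub>1 - 1 / z\<^sub>2)\<close>, where \<open>z\<^sub>1\<close>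
  is the larger constant. For the lower bounds, strict convexity of \<open>exp\<close> gives
  \<open>exp (- b) (b - a) < exp (- a) - exp (- b)\<close> for \<open>a < b\<close>; when \<open>z\<^sub>1 > z\<^sub>2\<close>, testing the two measures
  on \<open>{\<Phi>\<^sub>1 > \<Phi>\<^sub>2}\<close> already suffices, since replacing \<open>1 / z\<^sub>1\<close> by \<open>1 / z\<^sub>2\<close> there decreases the
  difference of the densities.
\<close>

section \<open>Pointwise inequalities for the exponential\<close>

text \<open>Dividing by \<open>exp (- b)\<close> reduces this to \<open>1 + t < exp t\<close> for
  \<open>t = b - a > 0\<close>. Strictness comes from squaring the non-strict bound
  \<open>1 + t / 2 \<le> exp (t / 2)\<close>, since the square exceeds \<open>1 + t\<close> by
  \<open>t^2 / 4\<close>.\<close>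

lemma exp_minus_diff_gt:
  fixes a b :: real
  assumes "a < b"
  shows "exp (- b) * (b - a) < exp (- a) - exp (- b)"
proof -
  define t where "t = b - a"
  have t: "t > 0" using assms by (simp add: t_def)
  have "1 + t < (1 + t / 2)^2"
    using t by (simp add: power2_eq_square field_simps)
  also have "\<dots> \<le> (exp (t / 2))^2"
    using t by (intro power_mono) auto
  also have "\<dots> = exp t"
    by (simp add: power2_eq_square flip: exp_add)
  finally have "exp (- b) * (1 + t) < exp (- b) * exp t"
    by simp
  then show ?thesis
    by (simp add: t_def algebra_simps flip: exp_add)
qed

text \<open>The preceding bound has the exponential at the larger argument as its factor. A common
  lower bound \<open>m\<close> of both exponentials can replace it whichever argument is larger,
  which makes the estimate symmetric.\<close>

lemma exp_minus_diff_lower: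
  fixes a b m :: real
  assumes "0 < m" "m \<le> exp (- a)" "m \<le> exp (- b)"
  shows "m * \<bar>a - b\<bar> \<le> \<bar>exp (- a) - exp (- b)\<bar>"
    and "a \<noteq> b \<Longrightarrow> m * \<bar>a - b\<bar> < \<bar>exp (- a) - exp (- b)\<bar>"
proof -
  have less: "m * \<bar>u - v\<bar> < \<bar>exp (- u) - exp (- v)\<bar>" if "u < v" "m \<le> exp (- v)" for u v :: real
  proof -
    have "m * \<bar>u - v\<bar> \<le> exp (- v) * (v - u)"
      using that by (simp add: mult_right_mono)
    also have "\<dots> < exp (- u) - exp (- v)"
      using that(1) by (rule exp_minus_diff_gt)
    finally show ?thesis by simp
  qed
  show strict: "m * \<bar>a - b\<bar> < \<bar>exp (- a) - exp (- b)\<bar>" if "a \<noteq> b"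
    using that less[of a b] less[of b a] assms by (cases "a < b") (auto simp: abs_minus_commute)
  show "m * \<bar>a - b\<bar> \<le> \<bar>exp (- a) - exp (- b)\<bar>"
    using strict by (cases "a = b") auto
qed

text \<open>On the nonnegative half-line \<open>exp (- x)\<close> is 1-Lipschitz: factoring out
  \<open>exp (- u) \<le> 1\<close> leaves \<open>1 - exp (- t) \<le> t\<close> with
  \<open>t = v - u\<close>.\<close>

lemma abs_exp_minus_diff_le:
  fixes a b :: real
  assumes "0 \<le> a" "0 \<le> b"
  shows "\<bar>exp (- a) - exp (- b)\<bar> \<le> \<bar>a - b\<bar>"
proof -
  have le: "exp (- u) - exp (- v) \<le> v - u" if "0 \<le> u" "u \<le> v" for u v :: real
  proof -
    have "exp (- u) - exp (- v) = exp (- u) * (1 - exp (- (v - u)))"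
      by (simp add: algebra_simps flip: exp_add)
    also have "\<dots> \<le> 1 * (1 - exp (- (v - u)))"
      using that by (intro mult_right_mono) auto
    also have "\<dots> \<le> v - u"
      using exp_ge_add_one_self[of "u - v"] unfolding minus_diff_eq mult_1 by linarith
    finally show ?thesis .
  qed
  show ?thesis
    using le[of a b] le[of b a] assms by (cases "a \<le> b") (auto simp: abs_if)
qed

section \<open>Equality case of the integral triangle inequality\<close>

text \<open>If \<open>g\<close> and its absolute value have the same integral, the nonnegative
  function \<open>\<bar>g x\<bar> - g x\<close> has integral zero and so vanishes almost everywhere.
  The outer absolute value leads to the two cases \<open>g = f\<close> and
  \<open>g = - f\<close>.\<close>

lemma abs_integral_eq_integral_abs_iff:
  fixes f :: "'a \<Rightarrow> real"
  assumes [simp]: "integrable M f"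
  shows "\<bar>\<integral>x. f x \<partial>M\<bar> = (\<integral>x. \<bar>f x\<bar> \<partial>M) \<longleftrightarrow> (AE x in M. 0 \<le> f x) \<or> (AE x in M. f x \<le> 0)"
proof -
  have *: "(\<integral>x. g x \<partial>M) = (\<integral>x. \<bar>g x\<bar> \<partial>M) \<longleftrightarrow> (AE x in M. 0 \<le> g x)"
    if [simp]: "integrable M g" for g :: "'a \<Rightarrow> real"
  proof -
    have "(\<integral>x. g x \<partial>M) = (\<integral>x. \<bar>g x\<bar> \<partial>M) \<longleftrightarrow> (\<integral>x. \<bar>g x\<bar> - g x \<partial>M) = 0"
      by auto
    also have "\<dots> \<longleftrightarrow> (AE x in M. \<bar>g x\<bar> - g x = 0)"
      by (intro integral_nonneg_eq_0_iff_AE) auto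
    also have "\<dots> \<longleftrightarrow> (AE x in M. 0 \<le> g x)"
      by (intro AE_cong) auto
    finally show ?thesis .
  qed
  have "(\<integral>x. \<bar>f x\<bar> \<partial>M) \<ge> 0" by simp
  then have "\<bar>\<integral>x. f x \<partial>M\<bar> = (\<integral>x. \<bar>f x\<bar> \<partial>M) \<longleftrightarrow>
      (\<integral>x. f x \<partial>M) = (\<integral>x. \<bar>f x\<bar> \<partial>M) \<or> (\<integral>x. - f x \<partial>M) = (\<integral>x. \<bar>- f x\<bar> \<partial>M)"
    unfolding integral_minus abs_minus_cancel by arith
  then show ?thesis
    using *[of f] *[of "\<lambda>x. - f x"] by simp
qed

section \<open>Total variation distance of measures given by densities\<close>

lemma integrable_indicator_mult:
  fixes f :: "'a \<Rightarrow> real"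
  shows "A \<in> sets M \<Longrightarrow> integrable M f \<Longrightarrow> integrable M (\<lambda>x. indicator A x * f x)"
  using integrable_real_mult_indicator[of A M f] by (simp add: mult.commute)

lemma measure_density_eq_integral:
  fixes f :: "'a \<Rightarrow> real"
  assumes f: "integrable M f" "\<And>x. 0 \<le> f x" and A: "A \<in> sets M"
  shows "measure (density M (\<lambda>x. ennreal (f x))) A = (\<integral>x. indicator A x * f x \<partial>M)"
proof -
  have "emeasure (density M (\<lambda>x. ennreal (f x))) A = (\<integral>\<^sup>+x. ennreal (f x) * indicator A x \<partial>M)"
    using f A by (intro emeasure_density) auto
  also have "\<dots> = (\<integral>\<^sup>+x. ennreal (indicator A x * f x) \<partial>M)"
    by (intro nn_integral_cong) (simp split: split_indicator)
  also have "\<dots> = ennreal (\<integral>x. indicator A x * f x \<partial>M)"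
    using f A by (intro nn_integral_eq_integral integrable_indicator_mult) auto
  finally show ?thesis
    using f by (simp add: measure_def)
qed

text \<open>A single test set bounds the supremum from below. This serves both for attaining the
  supremum in the next lemma and for the lower bound with unequal normalising constants.\<close>

lemma tv_dist_density_ge:
  fixes f g :: "'a \<Rightarrow> real"
  assumes "integrable M f" "\<And>x. 0 \<le> f x" "integrable M g" "\<And>x. 0 \<le> g x" "A \<in> sets M"
  shows "ennreal \<bar>\<integral>x. indicator A x * (f x - g x) \<partial>M\<bar>
    \<le> tv_dist (density M (\<lambda>x. ennreal (f x))) (density M (\<lambda>x. ennreal (g x)))"
proof -
  have "(\<integral>x. indicator A x * (f x - g x) \<partial>M)
      = (\<integral>x. indicator A x * f x \<partial>M) - (\<integral>x. indicator A x * g x \<partial>M)"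
    using assms by (simp add: right_diff_distrib integrable_indicator_mult)
  then show ?thesis
    unfolding tv_dist_def using assms
    by (intro SUP_upper2[of A]) (simp_all add: measure_density_eq_integral)
qed

text \<open>Equal total mass gives the difference of the densities integral zero, so the indicator
  may be replaced by a function of modulus \<open>1/2\<close>. This bounds every test set by half
  the \<open>L1\<close> distance, and the set where the difference is nonnegative attains
  it.\<close>

lemma tv_dist_density:
  fixes f g :: "'a \<Rightarrow> real"
  assumes f: "integrable M f" "\<And>x. 0 \<le> f x" and g: "integrable M g" "\<And>x. 0 \<le> g x"
    and eq: "(\<integral>x. f x \<partial>M) = (\<integral>x. g x \<partial>M)"
  shows "tv_dist (density M (\<lambda>x. ennreal (f x))) (density M (\<lambda>x. ennreal (g x)))
    = ennreal (1/2 * (\<integral>x. \<bar>f x - g x\<bar> \<partial>M))"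
proof -
  define d where "d x = f x - g x" for x
  have d[simp]: "integrable M d"
    unfolding d_def using f g by auto
  have [measurable]: "d \<in> borel_measurable M"
    using d by (rule borel_measurable_integrable)
  have d0: "(\<integral>x. d x \<partial>M) = 0"
    unfolding d_def using f g eq by simp
  \<comment> \<open>As \<open>d\<close> has integral zero, shifting the indicator by \<open>1/2\<close> turns \<open>\<integral>\<^sub>A d\<close> into an
     integral of \<open>\<plusminus> d/2\<close>.\<close>
  have shift: "(\<integral>x. indicator A x * d x \<partial>M) = (\<integral>x. (indicator A x - 1/2) * d x \<partial>M)"
    if "A \<in> sets M" for A
  proof -
    have "(\<integral>x. (indicator A x - 1/2) * d x \<partial>M) = (\<integral>x. indicator A x * d x - 1/2 * d x \<partial>M)"
      by (simp add: left_diff_distrib)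
    also have "\<dots> = (\<integral>x. indicator A x * d x \<partial>M) - 1/2 * (\<integral>x. d x \<partial>M)"
      using that by (subst Bochner_Integration.integral_diff) (auto intro: integrable_indicator_mult)
    finally show ?thesis using d0 by simp
  qed
  show ?thesis
  proof (rule antisym)
    have "\<bar>\<integral>x. indicator A x * d x \<partial>M\<bar> \<le> 1/2 * (\<integral>x. \<bar>d x\<bar> \<partial>M)" if "A \<in> sets M" for A
    proof -
      have "\<bar>\<integral>x. (indicator A x - 1/2) * d x \<partial>M\<bar> \<le> (\<integral>x. \<bar>(indicator A x - 1/2) * d x\<bar> \<partial>M)"
        by (rule integral_abs_bound)
      also have "\<dots> = (\<integral>x. 1/2 * \<bar>d x\<bar> \<partial>M)"
        by (intro Bochner_Integration.integral_cong) (auto simp: abs_mult split: split_indicator)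
      finally show ?thesis using shift[OF that] by simp
    qed
    then show "tv_dist (density M (\<lambda>x. ennreal (f x))) (density M (\<lambda>x. ennreal (g x)))
        \<le> ennreal (1/2 * (\<integral>x. \<bar>f x - g x\<bar> \<partial>M))"
      unfolding tv_dist_def using f g
      by (intro SUP_least ennreal_leI)
        (simp add: measure_density_eq_integral d_def right_diff_distrib integrable_indicator_mult)
  next
    \<comment> \<open>On this set the shifted indicator has the sign of \<open>d\<close>, so its
      product with \<open>d\<close> is exactly half of \<open>\<bar>d x\<bar>\<close> at every
      point.\<close>
    define A where "A = {x \<in> space M. 0 \<le> d x}"
    have A: "A \<in> sets M" unfolding A_def by measurable
    have "(\<integral>x. (indicator A x - 1/2) * d x \<partial>M) = (\<integral>x. 1/2 * \<bar>d x\<bar> \<partial>M)"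
      by (intro Bochner_Integration.integral_cong) (auto simp: A_def split: split_indicator)
    then have "(\<integral>x. indicator A x * d x \<partial>M) = 1/2 * (\<integral>x. \<bar>d x\<bar> \<partial>M)"
      using shift[OF A] by simp
    moreover have "0 \<le> (\<integral>x. \<bar>d x\<bar> \<partial>M)" by simp
    ultimately have "\<bar>\<integral>x. indicator A x * d x \<partial>M\<bar> = 1/2 * (\<integral>x. \<bar>d x\<bar> \<partial>M)"
      by linarith
    then show "ennreal (1/2 * (\<integral>x. \<bar>f x - g x\<bar> \<partial>M))
        \<le> tv_dist (density M (\<lambda>x. ennreal (f x))) (density M (\<lambda>x. ennreal (g x)))"
      using tv_dist_density_ge[OF f g A] by (simp only: d_def)
  qed
qed

lemma tv_dist_commute: "sets M = sets N \<Longrightarrow> tv_dist M N = tv_dist N M"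
  unfolding tv_dist_def by (simp add: abs_minus_commute)

lemma tv_dist_reweighted_commute:
  "tv_dist (reweighted M \<Phi>) (reweighted M \<Psi>) = tv_dist (reweighted M \<Psi>) (reweighted M \<Phi>)"
  by (rule tv_dist_commute) (simp add: reweighted_def)

lemma ennreal_half_mult: "0 \<le> x \<Longrightarrow> (1/2) * ennreal x = ennreal (1/2 * x)"
  using divide_ennreal[of 1 2] by (subst ennreal_mult') simp_all

section \<open>Upper bound for the distance of normalised densities\<close>

lemma integral_abs_normalized_diff_le:
  fixes f g :: "'a \<Rightarrow> real"
  assumes "integrable M f" "\<And>x. 0 \<le> f x" "integrable M g" "\<And>x. 0 \<le> g x"
    and "0 < (\<integral>x. f x \<partial>M)" "0 < (\<integral>x. g x \<partial>M)"
  shows "(\<integral>x. \<bar>f x / (\<integral>x. f x \<partial>M) - g x / (\<integral>x. g x \<partial>M)\<bar> \<partial>M)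
    \<le> 1 / max (\<integral>x. f x \<partial>M) (\<integral>x. g x \<partial>M)
      * ((\<integral>x. \<bar>f x - g x\<bar> \<partial>M) + \<bar>(\<integral>x. g x \<partial>M) - (\<integral>x. f x \<partial>M)\<bar>)"
proof -
  \<comment> \<open>The claim is first shown with the larger integral in first position. Then
    \<open>1 / V - 1 / U\<close> is nonnegative, and the correction term integrates to
    \<open>(U - V) / U\<close>.\<close>
  have *: "(\<integral>x. \<bar>u x / (\<integral>x. u x \<partial>M) - v x / (\<integral>x. v x \<partial>M)\<bar> \<partial>M)
      \<le> 1 / (\<integral>x. u x \<partial>M) * ((\<integral>x. \<bar>u x - v x\<bar> \<partial>M) + ((\<integral>x. u x \<partial>M) - (\<integral>x. v x \<partial>M)))"
    if uv: "integrable M u" "integrable M v" "\<And>x. 0 \<le> v x"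
      "0 < (\<integral>x. v x \<partial>M)" "(\<integral>x. v x \<partial>M) \<le> (\<integral>x. u x \<partial>M)" for u v :: "'a \<Rightarrow> real"
  proof -
    define U V where "U = (\<integral>x. u x \<partial>M)" and "V = (\<integral>x. v x \<partial>M)"
    have pos: "0 < V" "V \<le> U" using uv by (auto simp: U_def V_def)
    have "(\<integral>x. \<bar>u x / U - v x / V\<bar> \<partial>M) \<le> (\<integral>x. 1 / U * \<bar>u x - v x\<bar> + (1 / V - 1 / U) * v x \<partial>M)"
    proof (intro integral_mono)
      fix x
      have "u x / U - v x / V = 1 / U * (u x - v x) - (1 / V - 1 / U) * v x"
        by (simp add: algebra_simps diff_divide_distrib)
      also have "\<bar>\<dots>\<bar> \<le> \<bar>1 / U * (u x - v x)\<bar> + \<bar>(1 / V - 1 / U) * v x\<bar>"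
        by (rule abs_triangle_ineq4)
      also have "\<dots> = 1 / U * \<bar>u x - v x\<bar> + (1 / V - 1 / U) * v x"
        using pos uv(3)[of x] by (simp add: abs_mult frac_le)
      finally show "\<bar>u x / U - v x / V\<bar> \<le> \<dots>" .
    qed (use uv in auto)
    also have "\<dots> = 1 / U * (\<integral>x. \<bar>u x - v x\<bar> \<partial>M) + (1 / V - 1 / U) * V"
      using uv by (simp add: V_def)
    also have "(1 / V - 1 / U) * V = 1 / U * (U - V)"
      using pos by (simp add: field_simps)
    finally show ?thesis by (simp add: U_def V_def distrib_left)
  qed
  show ?thesis
  proof (cases "(\<integral>x. g x \<partial>M) \<le> (\<integral>x. f x \<partial>M)")
    case True
    then show ?thesis using *[of f g] assms by (simp add: max_absorb1)
  next
    case False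
    have "(\<integral>x. \<bar>g x / (\<integral>x. g x \<partial>M) - f x / (\<integral>x. f x \<partial>M)\<bar> \<partial>M)
        = (\<integral>x. \<bar>f x / (\<integral>x. f x \<partial>M) - g x / (\<integral>x. g x \<partial>M)\<bar> \<partial>M)"
      "(\<integral>x. \<bar>g x - f x\<bar> \<partial>M) = (\<integral>x. \<bar>f x - g x\<bar> \<partial>M)"
      by (simp_all add: abs_minus_commute)
    then show ?thesis using *[of g f] assms False by (simp add: max_absorb2)
  qed
qed

section \<open>Normalising constants and reweighted measures as real integrals\<close>

lemma integrable_exp_minus:
  assumes [measurable]: "\<Phi> \<in> borel_measurable M" and "Z_const M \<Phi> < \<infinity>"
  shows "integrable M (\<lambda>x. exp (- \<Phi> x))"
  using assms(2) by (intro integrableI_nonneg) (auto simp: Z_const_def)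

lemma Z_const_eq_integral:
  assumes "\<Phi> \<in> borel_measurable M" "Z_const M \<Phi> < \<infinity>"
  shows "Z_const M \<Phi> = ennreal (\<integral>x. exp (- \<Phi> x) \<partial>M)"
  unfolding Z_const_def using integrable_exp_minus[OF assms] by (rule nn_integral_eq_integral) auto

lemma reweighted_eq_density:
  assumes "\<Phi> \<in> borel_measurable M" "0 < Z_const M \<Phi>" "Z_const M \<Phi> < \<infinity>"
  shows "reweighted M \<Phi> = density M (\<lambda>x. ennreal (exp (- \<Phi> x) / (\<integral>x. exp (- \<Phi> x) \<partial>M)))"
  using assms unfolding reweighted_def by (simp add: Z_const_eq_integral divide_ennreal)

lemma tv_dist_reweighted:
  assumes 1: "\<Phi> \<in> borel_measurable M" "0 < Z_const M \<Phi>" "Z_const M \<Phi> < \<infinity>"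
    and 2: "\<Psi> \<in> borel_measurable M" "0 < Z_const M \<Psi>" "Z_const M \<Psi> < \<infinity>"
  shows "tv_dist (reweighted M \<Phi>) (reweighted M \<Psi>) = ennreal (1/2 * (\<integral>x.
    \<bar>exp (- \<Phi> x) / (\<integral>x. exp (- \<Phi> x) \<partial>M) - exp (- \<Psi> x) / (\<integral>x. exp (- \<Psi> x) \<partial>M)\<bar> \<partial>M))"
proof -
  have "0 < (\<integral>x. exp (- \<Phi> x) \<partial>M)" "0 < (\<integral>x. exp (- \<Psi> x) \<partial>M)"
    using 1 2 by (auto simp: Z_const_eq_integral)
  then show ?thesis
    unfolding reweighted_eq_density[OF 1] reweighted_eq_density[OF 2]
    using 1 2 by (intro tv_dist_density) (simp_all add: integrable_exp_minus)
qed

lemma L1_norm_eq_integral: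
  "integrable M f \<Longrightarrow> L1_norm M f = ennreal (\<integral>x. \<bar>f x\<bar> \<partial>M)"
  unfolding L1_norm_def by (rule nn_integral_eq_integral) auto

section \<open>Almost-everywhere consequences of essential bounds\<close>

text \<open>With essential infimum zero this gives nonnegativity almost everywhere, the range in
  which the 1-Lipschitz bound for \<open>exp (- x)\<close> applies.\<close>

lemma ess_inf_AE: "AE x in M. ess_inf M f \<le> ereal (f x)"
  using esssup_AE[of "\<lambda>x. - ereal (f x)" M]
  unfolding ess_inf_def by eventually_elim (simp add: ereal_uminus_le_reorder)

lemma L_infinity_AE:
  assumes "f \<in> L_infinity M"
  shows "AE x in M. \<bar>f x\<bar> \<le> enn2real (Linf_norm M f)"
  using esssup_AE[of "\<lambda>x. ennreal \<bar>f x\<bar>" M]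
proof eventually_elim
  case (elim x)
  have "Linf_norm M f < \<infinity>" using assms by (simp add: L_infinity_def)
  then have "ennreal \<bar>f x\<bar> \<le> ennreal (enn2real (Linf_norm M f))"
    using elim by (simp add: Linf_norm_def)
  then show ?case by (simp add: ennreal_le_iff)
qed

text \<open>This supplies the constant \<open>m\<close> of the lower bounds.\<close>

lemma L_infinity_exp_minus_ge:
  assumes "f \<in> L_infinity M"
  shows "AE x in M. exp (- enn2real (Linf_norm M f)) \<le> exp (- f x)"
  using L_infinity_AE[OF assms] by eventually_elim auto

lemma (in finite_measure) integrable_L_infinity:
  assumes "f \<in> L_infinity M"
  shows "integrable M f"
  using L_infinity_AE[OF assms] assms
  by (intro integrable_const_bound[of f "enn2real (Linf_norm M f)"]) (auto simp: L_infinity_def)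

section \<open>Lower bounds for the total variation distance\<close>

text \<open>The densities satisfy a strict pointwise bound almost everywhere on the test set, and
  strictness survives integration because that set has positive probability. Exchanging the two
  functions covers the opposite order of the constants.\<close>

lemma (in prob_space) tv_dist_reweighted_gt:
  assumes L: "\<Phi> \<in> L_infinity M" "\<Psi> \<in> L_infinity M"
    and Z: "0 < Z_const M \<Phi>" "Z_const M \<Phi> < \<infinity>" "0 < Z_const M \<Psi>" "Z_const M \<Psi> < \<infinity>"
    and le: "Z_const M \<Psi> \<le> Z_const M \<Phi>"
    and pos: "0 < prob {x \<in> space M. \<Phi> x > \<Psi> x}"
  shows "exp_neg_Linf M \<Phi> * inverse (Z_const M \<Psi>) *
      (\<integral>\<^sup>+x\<in>{x \<in> space M. \<Phi> x > \<Psi> x}. ennreal \<bar>\<Phi> x - \<Psi> x\<bar> \<partial>M)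
    < tv_dist (reweighted M \<Phi>) (reweighted M \<Psi>)"
proof -
  define A where "A = {x \<in> space M. \<Phi> x > \<Psi> x}"
  define u v where "u = (\<integral>x. exp (- \<Phi> x) \<partial>M)" and "v = (\<integral>x. exp (- \<Psi> x) \<partial>M)"
  define m where "m = exp (- enn2real (Linf_norm M \<Phi>))"
  have [measurable]: "\<Phi> \<in> borel_measurable M" "\<Psi> \<in> borel_measurable M"
    using L by (auto simp: L_infinity_def)
  have A[measurable]: "A \<in> sets M" unfolding A_def by measurable
  have uv: "Z_const M \<Phi> = ennreal u" "Z_const M \<Psi> = ennreal v"
    using Z by (simp_all add: u_def v_def Z_const_eq_integral)
  have v: "0 < v" "v \<le> u"
    using Z le unfolding uv by (auto simp: ennreal_le_iff2)
  have int[simp]: "integrable M \<Phi>" "integrable M \<Psi>"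
      "integrable M (\<lambda>x. exp (- \<Phi> x))" "integrable M (\<lambda>x. exp (- \<Psi> x))"
    using L Z by (auto intro: integrable_L_infinity integrable_exp_minus)
  have bound: "m * inverse v * (\<Phi> x - \<Psi> x) < exp (- \<Psi> x) / v - exp (- \<Phi> x) / u"
    if "m \<le> exp (- \<Phi> x)" "\<Psi> x < \<Phi> x" for x
  proof -
    have "m * (\<Phi> x - \<Psi> x) \<le> exp (- \<Phi> x) * (\<Phi> x - \<Psi> x)"
      using that by (intro mult_right_mono) auto
    also have "\<dots> < exp (- \<Psi> x) - exp (- \<Phi> x)"
      using that by (intro exp_minus_diff_gt)
    finally have "m * inverse v * (\<Phi> x - \<Psi> x) < (exp (- \<Psi> x) - exp (- \<Phi> x)) / v"
      using v(1) by (auto dest: divide_strict_right_mono[of _ _ v] simp: divide_inverse mult_ac)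
    \<comment> \<open>Since \<open>v \<le> u\<close>, dividing the subtracted term by
      \<open>u\<close> instead of \<open>v\<close> can only increase the difference.\<close>
    also have "\<dots> \<le> exp (- \<Psi> x) / v - exp (- \<Phi> x) / u"
      using v by (simp add: diff_divide_distrib frac_le)
    finally show ?thesis .
  qed
  have AE_m: "AE x in M. m \<le> exp (- \<Phi> x)"
    unfolding m_def using L(1) by (rule L_infinity_exp_minus_ge)
  have less: "(\<integral>x. indicator A x * (m * inverse v * (\<Phi> x - \<Psi> x)) \<partial>M)
      < (\<integral>x. indicator A x * (exp (- \<Psi> x) / v - exp (- \<Phi> x) / u) \<partial>M)"
  proof (rule integral_less_AE)
    show "emeasure M A \<noteq> 0"
      using pos by (simp add: A_def emeasure_eq_measure)
    show "AE x in M. x \<in> A \<longrightarrow> indicator A x * (m * inverse v * (\<Phi> x - \<Psi> x))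
        \<noteq> indicator A x * (exp (- \<Psi> x) / v - exp (- \<Phi> x) / u)"
      using AE_m by eventually_elim (auto simp: A_def dest: bound)
    show "AE x in M. indicator A x * (m * inverse v * (\<Phi> x - \<Psi> x))
        \<le> indicator A x * (exp (- \<Psi> x) / v - exp (- \<Phi> x) / u)"
      using AE_m by eventually_elim (auto simp: A_def split: split_indicator dest: bound)
  qed (auto intro!: integrable_indicator_mult)
  have "(\<integral>\<^sup>+x\<in>A. ennreal \<bar>\<Phi> x - \<Psi> x\<bar> \<partial>M) = (\<integral>\<^sup>+x. ennreal (indicator A x * (\<Phi> x - \<Psi> x)) \<partial>M)"
    by (intro nn_integral_cong) (auto simp: A_def split: split_indicator)
  also have "\<dots> = ennreal (\<integral>x. indicator A x * (\<Phi> x - \<Psi> x) \<partial>M)"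
    by (intro nn_integral_eq_integral integrable_indicator_mult)
      (auto simp: A_def split: split_indicator)
  finally have "exp_neg_Linf M \<Phi> * inverse (Z_const M \<Psi>) * (\<integral>\<^sup>+x\<in>A. ennreal \<bar>\<Phi> x - \<Psi> x\<bar> \<partial>M)
      = ennreal (m * inverse v * (\<integral>x. indicator A x * (\<Phi> x - \<Psi> x) \<partial>M))"
    using v by (simp add: uv exp_neg_Linf_def m_def inverse_ennreal ennreal_mult')
  also have "m * inverse v * (\<integral>x. indicator A x * (\<Phi> x - \<Psi> x) \<partial>M)
      = (\<integral>x. indicator A x * (m * inverse v * (\<Phi> x - \<Psi> x)) \<partial>M)"
    by (subst integral_mult_right_zero[symmetric]) (simp add: mult_ac)
  also have "ennreal \<dots> < ennreal \<bar>\<integral>x. indicator A x * (exp (- \<Psi> x) / v - exp (- \<Phi> x) / u) \<partial>M\<bar>"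
  proof -
    \<comment> \<open>Nonnegativity of the smaller integral makes the larger one positive, so its
      absolute value changes nothing and the strict inequality carries over to
      \<open>ennreal\<close>.\<close>
    have "0 \<le> (\<integral>x. indicator A x * (m * inverse v * (\<Phi> x - \<Psi> x)) \<partial>M)"
      using v by (intro integral_nonneg_AE) (auto simp: A_def m_def split: split_indicator)
    with less show ?thesis by (intro ennreal_lessI) auto
  qed
  \<comment> \<open>The arguments appear in swapped order because the density of
    \<open>\<Psi>\<close> is the minuend; symmetry of the distance restores the order.\<close>
  also have "\<dots> \<le> tv_dist (reweighted M \<Psi>) (reweighted M \<Phi>)"
    using Z v by (simp add: reweighted_eq_density flip: u_def v_def)
      (intro tv_dist_density_ge; simp)
  finally show ?thesis
    by (simp only: A_def tv_dist_reweighted_commute)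
qed

text \<open>With equal constants the factor \<open>1 / z\<close> leaves the total variation
  integral, and what remains is to compare the two exponentials with
  \<open>m * \<bar>\<Phi> x - \<Psi> x\<bar>\<close> pointwise. That comparison is strict wherever
  the functions differ and \<open>m\<close> bounds both exponentials from below.\<close>

lemma (in prob_space) tv_dist_reweighted_lower:
  assumes L: "\<Phi> \<in> L_infinity M" "\<Psi> \<in> L_infinity M"
    and Z: "0 < Z_const M \<Phi>" "Z_const M \<Phi> < \<infinity>" and eq: "Z_const M \<Psi> = Z_const M \<Phi>"
  defines "B \<equiv> (1/2) * (min (exp_neg_Linf M \<Phi>) (exp_neg_Linf M \<Psi>) / Z_const M \<Phi>)
    * L1_norm M (\<lambda>x. \<Phi> x - \<Psi> x)"
  shows "B \<le> tv_dist (reweighted M \<Phi>) (reweighted M \<Psi>)"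
    and "0 < prob {x \<in> space M. \<Phi> x \<noteq> \<Psi> x} \<Longrightarrow>
      B < tv_dist (reweighted M \<Phi>) (reweighted M \<Psi>)"
proof -
  define z where "z = (\<integral>x. exp (- \<Phi> x) \<partial>M)"
  define m where "m = min (exp (- enn2real (Linf_norm M \<Phi>))) (exp (- enn2real (Linf_norm M \<Psi>)))"
  have [measurable]: "\<Phi> \<in> borel_measurable M" "\<Psi> \<in> borel_measurable M"
    using L by (auto simp: L_infinity_def)
  have int[simp]: "integrable M \<Phi>" "integrable M \<Psi>"
      "integrable M (\<lambda>x. exp (- \<Phi> x))" "integrable M (\<lambda>x. exp (- \<Psi> x))"
    using L Z eq by (auto intro: integrable_L_infinity integrable_exp_minus)
  have zZ: "Z_const M \<Phi> = ennreal z" "Z_const M \<Psi> = ennreal (\<integral>x. exp (- \<Psi> x) \<partial>M)"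
    using Z_const_eq_integral[of \<Phi> M] Z_const_eq_integral[of \<Psi> M] Z eq by (simp_all add: z_def)
  have z: "0 < z" using Z by (simp add: zZ)
  have z': "(\<integral>x. exp (- \<Psi> x) \<partial>M) = z"
    using eq z unfolding zZ by (subst (asm) ennreal_inj) auto
  have m: "0 < m" by (simp add: m_def)
  have min: "min (exp_neg_Linf M \<Phi>) (exp_neg_Linf M \<Psi>) = ennreal m"
    by (simp add: exp_neg_Linf_def m_def min_def)
  have tv: "tv_dist (reweighted M \<Phi>) (reweighted M \<Psi>)
      = ennreal (1/2 * (1 / z * (\<integral>x. \<bar>exp (- \<Phi> x) - exp (- \<Psi> x)\<bar> \<partial>M)))"
  proof -
    have "(\<integral>x. \<bar>exp (- \<Phi> x) / z - exp (- \<Psi> x) / z\<bar> \<partial>M)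
        = (\<integral>x. \<bar>exp (- \<Phi> x) - exp (- \<Psi> x)\<bar> / z \<partial>M)"
      using z by (simp flip: diff_divide_distrib)
    then show ?thesis
      using Z eq by (subst tv_dist_reweighted) (simp_all add: z' flip: z_def)
  qed
  have B: "B = ennreal (1/2 * (1 / z * (m * (\<integral>x. \<bar>\<Phi> x - \<Psi> x\<bar> \<partial>M))))"
  proof -
    have "B = 1/2 * ennreal (m / z * (\<integral>x. \<bar>\<Phi> x - \<Psi> x\<bar> \<partial>M))"
      unfolding B_def min zZ(1) using z m
      by (subst ennreal_mult) (simp_all add: L1_norm_eq_integral divide_ennreal mult.assoc)
    also have "\<dots> = ennreal (1/2 * (m / z * (\<integral>x. \<bar>\<Phi> x - \<Psi> x\<bar> \<partial>M)))"
      using z m by (intro ennreal_half_mult) simp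
    finally show ?thesis by simp
  qed
  have AE_m: "AE x in M. m \<le> exp (- \<Phi> x) \<and> m \<le> exp (- \<Psi> x)"
    using L_infinity_exp_minus_ge[OF L(1)] L_infinity_exp_minus_ge[OF L(2)]
    by eventually_elim (auto simp: m_def min_le_iff_disj)
  have AE_le: "AE x in M. m * \<bar>\<Phi> x - \<Psi> x\<bar> \<le> \<bar>exp (- \<Phi> x) - exp (- \<Psi> x)\<bar>"
    using AE_m by eventually_elim (use exp_minus_diff_lower m in auto)
  show "B \<le> tv_dist (reweighted M \<Phi>) (reweighted M \<Psi>)"
  proof -
    have "m * (\<integral>x. \<bar>\<Phi> x - \<Psi> x\<bar> \<partial>M) \<le> (\<integral>x. \<bar>exp (- \<Phi> x) - exp (- \<Psi> x)\<bar> \<partial>M)"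
      by (subst integral_mult_right_zero[symmetric]) (intro integral_mono_AE AE_le; simp)
    then show ?thesis
      unfolding B tv using z by (intro ennreal_leI mult_left_mono) auto
  qed
  show "B < tv_dist (reweighted M \<Phi>) (reweighted M \<Psi>)"
    if pos: "0 < prob {x \<in> space M. \<Phi> x \<noteq> \<Psi> x}"
  proof -
    have "(\<integral>x. m * \<bar>\<Phi> x - \<Psi> x\<bar> \<partial>M) < (\<integral>x. \<bar>exp (- \<Phi> x) - exp (- \<Psi> x)\<bar> \<partial>M)"
    proof (rule integral_less_AE[where A = "{x \<in> space M. \<Phi> x \<noteq> \<Psi> x}"])
      show "emeasure M {x \<in> space M. \<Phi> x \<noteq> \<Psi> x} \<noteq> 0"
        using pos by (simp add: emeasure_eq_measure)
      show "AE x in M. x \<in> {x \<in> space M. \<Phi> x \<noteq> \<Psi> x} \<longrightarrow>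
          m * \<bar>\<Phi> x - \<Psi> x\<bar> \<noteq> \<bar>exp (- \<Phi> x) - exp (- \<Psi> x)\<bar>"
        using AE_m by eventually_elim (use exp_minus_diff_lower(2) m in fastforce)
    qed (use AE_le in auto)
    then have "1/2 * (1 / z * (m * (\<integral>x. \<bar>\<Phi> x - \<Psi> x\<bar> \<partial>M)))
        < 1/2 * (1 / z * (\<integral>x. \<bar>exp (- \<Phi> x) - exp (- \<Psi> x)\<bar> \<partial>M))"
      using z by (intro mult_strict_left_mono) auto
    then show ?thesis
      unfolding B tv using z m by (intro ennreal_lessI) (auto intro: order_le_less_trans[rotated])
  qed
qed

section \<open>Assembly of the bounds and of their equality cases\<close>

theorem proposition3p5:
  fixes \<mu> :: "'a measure" and \<Phi>1 \<Phi>2 :: "'a \<Rightarrow> real"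
  assumes "prob_space \<mu>"
    and "\<Phi>1 \<in> borel_measurable \<mu>" and "\<Phi>2 \<in> borel_measurable \<mu>"
    and "0 < Z_const \<mu> \<Phi>1" and "Z_const \<mu> \<Phi>1 < \<infinity>"
    and "0 < Z_const \<mu> \<Phi>2" and "Z_const \<mu> \<Phi>2 < \<infinity>"
  defines "Z1 \<equiv> Z_const \<mu> \<Phi>1" and "Z2 \<equiv> Z_const \<mu> \<Phi>2"
    and "dTV \<equiv> tv_dist (reweighted \<mu> \<Phi>1) (reweighted \<mu> \<Phi>2)"
    and "expL1 \<equiv> L1_norm \<mu> (\<lambda>x. exp (- \<Phi>1 x) - exp (- \<Phi>2 x))"
    and "L1 \<equiv> L1_norm \<mu> (\<lambda>x. \<Phi>1 x - \<Phi>2 x)"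
  shows
    "(ess_inf \<mu> \<Phi>1 = 0 \<and> ess_inf \<mu> \<Phi>2 = 0 \<longrightarrow>
        ennreal_absdiff Z2 Z1 \<le> expL1 \<and> expL1 \<le> L1 \<and>
        dTV \<le> (1/2) * (1 / max Z1 Z2) * (expL1 + ennreal_absdiff Z2 Z1) \<and>
        ((AE x in \<mu>. \<Phi>1 x = \<Phi>2 x) \<longrightarrow>
           expL1 = L1 \<and>
           dTV = (1/2) * (1 / max Z1 Z2) * (expL1 + ennreal_absdiff Z2 Z1)) \<and>
        (ennreal_absdiff Z2 Z1 = expL1 \<longleftrightarrow>
           (AE x in \<mu>. \<Phi>1 x \<ge> \<Phi>2 x) \<or> (AE x in \<mu>. \<Phi>1 x \<le> \<Phi>2 x)))
     \<and>
     (\<Phi>1 \<in> L_infinity \<mu> \<and> \<Phi>2 \<in> L_infinity \<mu> \<and>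
      measure \<mu> {x \<in> space \<mu>. \<Phi>1 x - \<Phi>2 x > 0} > 0 \<and>
      measure \<mu> {x \<in> space \<mu>. \<Phi>1 x - \<Phi>2 x < 0} > 0 \<longrightarrow>
        dTV > (if Z1 = Z2 then
                 (1/2) * (min (exp_neg_Linf \<mu> \<Phi>1) (exp_neg_Linf \<mu> \<Phi>2) / min Z1 Z2) * L1
               else if Z1 > Z2 then
                 exp_neg_Linf \<mu> \<Phi>1 * inverse Z2 *
                   (\<integral>\<^sup>+ x \<in> {x \<in> space \<mu>. \<Phi>1 x > \<Phi>2 x}. ennreal \<bar>\<Phi>1 x - \<Phi>2 x\<bar> \<partial>\<mu>)
               else
                 exp_neg_Linf \<mu> \<Phi>2 * inverse Z1 *
                   (\<integral>\<^sup>+ x \<in> {x \<in> space \<mu>. \<Phi>2 x > \<Phi>1 x}. ennreal \<bar>\<Phi>1 x - \<Phi>2 x\<bar> \<partial>\<mu>)))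
     \<and>
     (\<Phi>1 \<in> L_infinity \<mu> \<and> \<Phi>2 \<in> L_infinity \<mu> \<and>
      (measure \<mu> {x \<in> space \<mu>. \<Phi>1 x - \<Phi>2 x \<ge> 0} = 1 \<or>
       measure \<mu> {x \<in> space \<mu>. \<Phi>1 x - \<Phi>2 x \<le> 0} = 1) \<longrightarrow>
        dTV \<ge> (if Z1 = Z2 then
                 (1/2) * (min (exp_neg_Linf \<mu> \<Phi>1) (exp_neg_Linf \<mu> \<Phi>2) / min Z1 Z2) * L1
               else 0))"
proof -
  interpret prob_space \<mu> by fact
  note meas[measurable] = assms(2,3)
  \<comment> \<open>Real counterparts of the finite quantities, so that subtraction and cancellation
    take place in the reals.\<close>
  define z1 z2 e where "z1 = (\<integral>x. exp (- \<Phi>1 x) \<partial>\<mu>)" and "z2 = (\<integral>x. exp (- \<Phi>2 x) \<partial>\<mu>)"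
    and "e = (\<integral>x. \<bar>exp (- \<Phi>1 x) - exp (- \<Phi>2 x)\<bar> \<partial>\<mu>)"
  have int[simp]: "integrable \<mu> (\<lambda>x. exp (- \<Phi>1 x))" "integrable \<mu> (\<lambda>x. exp (- \<Phi>2 x))"
    using assms(2-7) by (intro integrable_exp_minus; simp)+
  have Z: "Z1 = ennreal z1" "Z2 = ennreal z2"
    unfolding Z1_def Z2_def z1_def z2_def using assms(2-7) by (intro Z_const_eq_integral; simp)+
  have z: "0 < z1" "0 < z2"
    using assms(4,6) Z by (simp_all add: Z1_def Z2_def)
  have expL1: "expL1 = ennreal e"
    by (simp add: expL1_def e_def L1_norm_eq_integral)
  have e: "0 \<le> e" by (simp add: e_def)
  have absdiff: "ennreal_absdiff Z2 Z1 = ennreal \<bar>z2 - z1\<bar>"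
    using z by (simp add: ennreal_absdiff_def Z)
  have diff: "z1 - z2 = (\<integral>x. exp (- \<Phi>1 x) - exp (- \<Phi>2 x) \<partial>\<mu>)"
    by (simp add: z1_def z2_def)
  have maxZ: "max Z1 Z2 = ennreal (max z1 z2)"
    using z by (simp add: Z max_def)
  have B: "(1/2) * (1 / max Z1 Z2) * (expL1 + ennreal_absdiff Z2 Z1)
      = ennreal (1/2 * (1 / max z1 z2 * (e + \<bar>z2 - z1\<bar>)))"
  proof -
    have "1 / max Z1 Z2 = ennreal (1 / max z1 z2)"
      using divide_ennreal[of 1 "max z1 z2"] z by (simp add: maxZ)
    then show ?thesis
      unfolding expL1 absdiff using z e
      by (simp add: mult.assoc ennreal_half_mult del: times_divide_eq_left flip: ennreal_mult ennreal_plus)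
  qed
  have dTV: "dTV = ennreal (1/2 * (\<integral>x. \<bar>exp (- \<Phi>1 x) / z1 - exp (- \<Phi>2 x) / z2\<bar> \<partial>\<mu>))"
    unfolding dTV_def z1_def z2_def using assms(2-7) by (intro tv_dist_reweighted)

  have "ennreal_absdiff Z2 Z1 \<le> expL1"
    unfolding absdiff expL1 e_def
    by (intro ennreal_leI) (simp only: abs_minus_commute[of z2] diff integral_abs_bound)
  moreover have "expL1 \<le> L1" if "ess_inf \<mu> \<Phi>1 = 0" "ess_inf \<mu> \<Phi>2 = 0"
    unfolding expL1_def L1_def L1_norm_def
  proof (rule nn_integral_mono_AE)
    show "AE x in \<mu>. ennreal \<bar>exp (- \<Phi>1 x) - exp (- \<Phi>2 x)\<bar> \<le> ennreal \<bar>\<Phi>1 x - \<Phi>2 x\<bar>"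
      using ess_inf_AE[of \<mu> \<Phi>1] ess_inf_AE[of \<mu> \<Phi>2] unfolding that
      by eventually_elim (auto intro!: ennreal_leI abs_exp_minus_diff_le)
  qed
  moreover have "dTV \<le> (1/2) * (1 / max Z1 Z2) * (expL1 + ennreal_absdiff Z2 Z1)"
    unfolding B dTV
    using integral_abs_normalized_diff_le[OF int(1) _ int(2)] z
    unfolding z1_def[symmetric] z2_def[symmetric] e_def[symmetric]
    by (intro ennreal_leI mult_left_mono) auto
  \<comment> \<open>Both equalities hold because all the quantities compared are zero.\<close>
  moreover have "expL1 = L1 \<and> dTV = (1/2) * (1 / max Z1 Z2) * (expL1 + ennreal_absdiff Z2 Z1)"
    if "AE x in \<mu>. \<Phi>1 x = \<Phi>2 x"
  proof -
    have "e = (\<integral>x. 0 \<partial>\<mu>)"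
      unfolding e_def using that by (intro integral_cong_AE) auto
    then have e0: "e = 0" by simp
    have z12: "z1 = z2"
      unfolding z1_def z2_def using that by (intro integral_cong_AE) auto
    have "(\<integral>x. \<bar>exp (- \<Phi>1 x) / z1 - exp (- \<Phi>2 x) / z2\<bar> \<partial>\<mu>) = (\<integral>x. 0 \<partial>\<mu>)"
      unfolding z12 using that by (intro integral_cong_AE) auto
    then have "dTV = 0" by (simp add: dTV)
    moreover have "L1 = (\<integral>\<^sup>+x. 0 \<partial>\<mu>)"
      unfolding L1_def L1_norm_def using that by (intro nn_integral_cong_AE) auto
    ultimately show ?thesis
      by (simp add: absdiff expL1 e0 z12)
  qed
  moreover have "ennreal_absdiff Z2 Z1 = expL1 \<longleftrightarrow>
      (AE x in \<mu>. \<Phi>1 x \<ge> \<Phi>2 x) \<or> (AE x in \<mu>. \<Phi>1 x \<le> \<Phi>2 x)"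
  proof -
    have "ennreal_absdiff Z2 Z1 = expL1 \<longleftrightarrow> \<bar>z1 - z2\<bar> = e"
      unfolding absdiff expL1 using e by (simp add: abs_minus_commute)
    \<comment> \<open>As \<open>exp (- x)\<close> is decreasing, the difference of the exponentials
      has the opposite sign to \<open>\<Phi>1 x - \<Phi>2 x\<close>.\<close>
    also have "\<dots> \<longleftrightarrow> (AE x in \<mu>. \<Phi>1 x \<le> \<Phi>2 x) \<or> (AE x in \<mu>. \<Phi>2 x \<le> \<Phi>1 x)"
      unfolding diff e_def by (subst abs_integral_eq_integral_abs_iff) auto
    finally show ?thesis by blast
  qed
  moreover have "dTV > (if Z1 = Z2 then
        (1/2) * (min (exp_neg_Linf \<mu> \<Phi>1) (exp_neg_Linf \<mu> \<Phi>2) / min Z1 Z2) * L1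
      else if Z1 > Z2 then
        exp_neg_Linf \<mu> \<Phi>1 * inverse Z2 *
          (\<integral>\<^sup>+ x \<in> {x \<in> space \<mu>. \<Phi>1 x > \<Phi>2 x}. ennreal \<bar>\<Phi>1 x - \<Phi>2 x\<bar> \<partial>\<mu>)
      else
        exp_neg_Linf \<mu> \<Phi>2 * inverse Z1 *
          (\<integral>\<^sup>+ x \<in> {x \<in> space \<mu>. \<Phi>2 x > \<Phi>1 x}. ennreal \<bar>\<Phi>1 x - \<Phi>2 x\<bar> \<partial>\<mu>))"
    if L: "\<Phi>1 \<in> L_infinity \<mu>" "\<Phi>2 \<in> L_infinity \<mu>"
      and pos: "prob {x \<in> space \<mu>. \<Phi>1 x - \<Phi>2 x > 0} > 0" "prob {x \<in> space \<mu>. \<Phi>1 x - \<Phi>2 x < 0} > 0"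
  proof -
    consider "Z1 = Z2" | "Z2 < Z1" | "Z1 < Z2" by fastforce
    then show ?thesis
    proof cases
      case 1
      \<comment> \<open>The strict lower bound asks for the functions to differ with positive
        probability.\<close>
      have "prob {x \<in> space \<mu>. \<Phi>1 x - \<Phi>2 x > 0} \<le> prob {x \<in> space \<mu>. \<Phi>1 x \<noteq> \<Phi>2 x}"
        by (intro finite_measure_mono) auto
      with pos have "0 < prob {x \<in> space \<mu>. \<Phi>1 x \<noteq> \<Phi>2 x}"
        by linarith
      with tv_dist_reweighted_lower(2)[OF L assms(4,5) 1[symmetric, unfolded Z1_def Z2_def]]
      show ?thesis
        using 1 by (simp flip: Z1_def dTV_def L1_def)
    next
      case 2
      then show ?thesis
        using tv_dist_reweighted_gt[OF L assms(4-7)] pos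
        by (auto simp flip: Z1_def Z2_def dTV_def)
    next
      case 3
      then show ?thesis
        using tv_dist_reweighted_gt[OF L(2,1) assms(6,7,4,5)] pos
        unfolding tv_dist_reweighted_commute[of \<mu> \<Phi>2]
        by (auto simp add: abs_minus_commute simp flip: Z1_def Z2_def dTV_def)
    qed
  qed
  moreover have "dTV \<ge> (if Z1 = Z2 then
        (1/2) * (min (exp_neg_Linf \<mu> \<Phi>1) (exp_neg_Linf \<mu> \<Phi>2) / min Z1 Z2) * L1
      else 0)"
    if L: "\<Phi>1 \<in> L_infinity \<mu>" "\<Phi>2 \<in> L_infinity \<mu>"
  proof (cases "Z1 = Z2")
    case True
    with tv_dist_reweighted_lower(1)[OF L assms(4,5) True[symmetric, unfolded Z1_def Z2_def]]
    show ?thesis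
      by (simp flip: Z1_def dTV_def L1_def)
  qed simp
  ultimately show ?thesis by blast
qed

end
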